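(* Let $D$ be a balanced bipartite digraph with colour classes of cardinalities $a$, where $a\geq 2$. If $\delta(D)\geq (3a+1)/2$, then $D$ contains an oriented cycle of length $2a$.
   Context: A digraph $D$ consists of a finite vertex set $V(D)$ and a set $A(D)$ of ordered pairs of distinct vertices (arcs); no loops or multiple arcs, but both $uv$ and $vu$ may be arcs. For $v\in V(D)$, $d_D(v)=d_D^+(v)+d_D^-(v)$ is the sum of its outdegree and indegree, and $\delta(D)=\min_{v\in V(D)} d_D(v)$. A digraph is bipartite with colour classes $X,Y$ if $V(D)$ is the disjoint union of $X,Y$ and every arc goes between $X$ and $Y$; it is balanced if $|X|=|Y|$. *)

theory Defs
  imports Complex_Main "Graph_Theory.Graph_Theory"
begin

definition degree :: "('a, 'b) pre_digraph \<Rightarrow> 'a \<Rightarrow> nat" where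
  "degree G v = out_degree G v + in_degree G v"

text \<open>Only meaningful when \<open>G\<close> has a finite nonempty vertex set.\<close>
definition min_degree :: "('a, 'b) pre_digraph \<Rightarrow> nat" where
  "min_degree G = Min (degree G ` verts G)"

definition bipartite_digraph :: "('a, 'b) pre_digraph \<Rightarrow> 'a set \<Rightarrow> 'a set \<Rightarrow> bool" where
  "bipartite_digraph G X Y \<longleftrightarrow>
     verts G = X \<union> Y \<and> X \<inter> Y = {} \<and>
     (\<forall>e \<in> arcs G. (tail G e \<in> X \<and> head G e \<in> Y) \<or> (tail G e \<in> Y \<and> head G e \<in> X))"

definition balanced_bipartite_digraph ::
    "('a, 'b) pre_digraph \<Rightarrow> 'a set \<Rightarrow> 'a set \<Rightarrow> bool" where
  "balanced_bipartite_digraph G X Y \<longleftrightarrow> bipartite_digraph G X Y \<and> card X = card Y"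

text \<open>
  An oriented cycle is one whose arcs are all traversed in their own direction, which is
  \<open>pre_digraph.cycle\<close> of the library: a nonempty closed walk, given as its list of arcs,
  without repeated vertices except that the first is the last. Its length is therefore the
  length of that list. Since the digraphs considered have no loops, such a cycle
  has length at least 2 (the closed walk \<open>u, v, u\<close> along two opposite arcs is a cycle).
\<close>
definition has_oriented_cycle :: "('a, 'b) pre_digraph \<Rightarrow> nat \<Rightarrow> bool" where
  "has_oriented_cycle G n \<longleftrightarrow> (\<exists>p. pre_digraph.cycle G p \<and> length p = n)"

end

theory Submission
  imports Defs
begin

text \<open>
  A cycle factor is a permutation \<open>\<sigma>\<close> of the vertices with an arc from \<open>v\<close> to \<open>\<sigma> v\<close> for
  every \<open>v\<close>; it exchanges the two colour classes. Composing \<open>\<sigma>\<close> with the transposition of two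
  vertices \<open>u\<close>, \<open>v\<close> of the same class replaces the arcs from \<open>u\<close> to \<open>\<sigma> u\<close> and from \<open>v\<close> to
  \<open>\<sigma> v\<close> by those from \<open>u\<close> to \<open>\<sigma> v\<close> and from \<open>v\<close> to \<open>\<sigma> u\<close>. As all half-degrees are at
  least \<open>(a + 1) / 2\<close>, such exchanges turn any class-exchanging permutation into a cycle factor.
  If \<open>u\<close> and \<open>v\<close> lie on different cycles, the exchange merges the two. So if no exchange can
  merge a cycle \<open>C\<close> with another one, then the arcs from \<open>u \<in> C\<close> and into \<open>\<sigma> u\<close> number at most
  \<open>a + |C| / 2\<close>; summing over \<open>C\<close>, the degree condition forces \<open>|C| > a\<close>, which cannot
  hold for two disjoint cycles.
\<close>

section \<open>Orbits of a permutation composed with a transposition\<close>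

text \<open>From \<open>u\<close>, \<open>\<tau>\<close> jumps to \<open>\<sigma> v\<close> and
  follows the \<open>\<sigma>\<close>-cycle of \<open>v\<close>, which avoids \<open>u\<close>, up
  to \<open>v\<close>; from there it returns to \<open>\<sigma> u\<close>. The inclusion covers
  every \<open>w\<close> because the potential maximised later sums over all vertices.\<close>

lemma orbit_comp_transpose:
  assumes "permutation \<sigma>" and "v \<notin> orbit \<sigma> u"
  defines "\<tau> \<equiv> \<sigma> \<circ> transpose u v"
  shows "v \<in> orbit \<tau> u" and "orbit \<sigma> w \<subseteq> orbit \<tau> w"
proof -
  have self: "s \<in> orbit \<sigma> s" for s
    using assms(1) by (rule permutation_self_in_orbit)
  have u: "\<tau> u = \<sigma> v" and v: "\<tau> v = \<sigma> u"
    and other: "\<And>s. s \<noteq> u \<Longrightarrow> s \<noteq> v \<Longrightarrow> \<tau> s = \<sigma> s"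
    by (auto simp: \<tau>_def)
  \<comment> \<open>Used for both \<open>(u, v)\<close> and \<open>(v, u)\<close>. In the induction,
    \<open>s = p\<close> is excluded, and at \<open>s = q\<close> the successor
    \<open>\<sigma> q\<close> is \<open>\<tau> p\<close>, which is in the orbit already.\<close>
  have *: "q \<in> orbit \<tau> p" if "\<tau> p = \<sigma> q" "\<tau> q = \<sigma> p" "p \<notin> orbit \<sigma> q"
    "\<And>s. s \<noteq> p \<Longrightarrow> s \<noteq> q \<Longrightarrow> \<tau> s = \<sigma> s" for p q
  proof -
    have "s \<in> orbit \<tau> p" if "s \<in> orbit \<sigma> q" for s
      using that
    proof induction
      case base
      then show ?case using \<open>\<tau> p = \<sigma> q\<close> by (metis orbit.base)
    next
      case (step s)
      then show ?case
        using that \<open>\<tau> p = \<sigma> q\<close> \<open>p \<notin> orbit \<sigma> q\<close>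
        by (metis \<open>\<And>s. \<lbrakk>s \<noteq> p; s \<noteq> q\<rbrakk> \<Longrightarrow> \<tau> s = \<sigma> s\<close> orbit.base orbit.step)
    qed
    then show ?thesis using self by blast
  qed
  have "u \<notin> orbit \<sigma> v"
    using assms(2) self orbit_swap by metis
  then show vu: "v \<in> orbit \<tau> u"
    using *[of u v] u v other by blast
  have uv: "u \<in> orbit \<tau> v"
    using *[of v u] u v other assms(2) by blast
  have succ: "\<sigma> s \<in> orbit \<tau> s" for s
    using vu uv u v other by (metis orbit.base orbit.step)
  show "orbit \<sigma> w \<subseteq> orbit \<tau> w"
  proof
    fix s assume "s \<in> orbit \<sigma> w"
    then show "s \<in> orbit \<tau> w"
      by induction (auto intro: succ orbit_trans)
  qed
qed

section \<open>Balanced bipartite arc relations and class-exchanging permutations\<close>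

locale dense_balanced_bipartite =
  fixes X Y :: "'v set" and R :: "'v rel" and a :: nat
  assumes finite_X: "finite X" and finite_Y: "finite Y" and disjoint: "X \<inter> Y = {}"
    and card_X: "card X = a" and card_Y: "card Y = a"
    and arcs: "R \<subseteq> X \<times> Y \<union> Y \<times> X"
    and dense: "\<And>v. v \<in> X \<union> Y \<Longrightarrow> 3 * a + 1 \<le> 2 * (card (R `` {v}) + card (R\<inverse> `` {v}))"
begin

abbreviation "V \<equiv> X \<union> Y"

text \<open>For \<open>v\<close> in \<open>V\<close>, the possible exchange partners of
  \<open>v\<close>. The default \<open>Y\<close> outside \<open>V\<close> lets finiteness and
  cardinality hold for every \<open>v\<close>.\<close>

definition side :: "'v \<Rightarrow> 'v set" where
  "side v = (if v \<in> X then X else Y)"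

text \<open>A cycle factor of the complete bipartite digraph on \<open>X\<close> and
  \<open>Y\<close>: arcs of \<open>R\<close> are not demanded yet, so exchanges can start from any
  such permutation.\<close>

definition alternating :: "('v \<Rightarrow> 'v) \<Rightarrow> bool" where
  "alternating \<sigma> \<longleftrightarrow> \<sigma> permutes V \<and> (\<forall>v\<in>V. \<sigma> v \<in> X \<longleftrightarrow> v \<notin> X)"

definition cycle_factor :: "('v \<Rightarrow> 'v) \<Rightarrow> bool" where
  "cycle_factor \<sigma> \<longleftrightarrow> alternating \<sigma> \<and> (\<forall>v\<in>V. (v, \<sigma> v) \<in> R)"

lemma finite_V: "finite V"
  using finite_X finite_Y by simp

lemma card_V: "card V = 2 * a"
  using card_Un_disjoint[OF finite_X finite_Y disjoint] card_X card_Y by simp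

lemma card_side: "card (side v) = a"
  by (simp add: side_def card_X card_Y)

lemma finite_side: "finite (side v)"
  by (simp add: side_def finite_X finite_Y)

lemma alternatingD:
  assumes "alternating \<sigma>"
  shows "\<sigma> permutes V" "permutation \<sigma>" "inj \<sigma>" "v \<in> V \<Longrightarrow> \<sigma> v \<in> V"
    "v \<in> V \<Longrightarrow> \<sigma> v \<in> X \<longleftrightarrow> v \<notin> X"
proof -
  show *: "\<sigma> permutes V"
    using assms by (simp add: alternating_def)
  then show "permutation \<sigma>"
    using finite_V by (auto simp only: permutation_permutes)
  show "inj \<sigma>"
    using * by (rule permutes_inj)
  show "v \<in> V \<Longrightarrow> \<sigma> v \<in> V"
    by (simp only: permutes_in_image[OF *])
  show "v \<in> V \<Longrightarrow> \<sigma> v \<in> X \<longleftrightarrow> v \<notin> X"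
    using assms by (simp only: alternating_def)
qed

lemma alternating_image_side:
  assumes "alternating \<sigma>" and "v \<in> V"
  shows "\<sigma> ` side v = side (\<sigma> v)"
proof (rule card_subset_eq)
  show "\<sigma> ` side v \<subseteq> side (\<sigma> v)"
    using alternatingD[OF assms(1)] assms(2) disjoint by (auto simp: side_def split: if_splits; blast)
  show "card (\<sigma> ` side v) = card (side (\<sigma> v))"
    using alternatingD(3)[OF assms(1)] by (simp add: card_image inj_on_subset card_side)
qed (rule finite_side)

lemma out_side: "alternating \<sigma> \<Longrightarrow> v \<in> V \<Longrightarrow> R `` {v} \<subseteq> side (\<sigma> v)"
  using arcs disjoint alternatingD(4,5)[of \<sigma> v] by (auto simp: side_def)

lemma in_side: "alternating \<sigma> \<Longrightarrow> v \<in> V \<Longrightarrow> R\<inverse> `` {\<sigma> v} \<subseteq> side v"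
  using arcs disjoint alternatingD(4,5)[of \<sigma> v] by (auto simp: side_def)

lemma alternating_exists: "\<exists>\<sigma>. alternating \<sigma>"
proof -
  obtain h where h: "bij_betw h X Y"
    using finite_same_card_bij[OF finite_X finite_Y] card_X card_Y by auto
  define \<sigma> where "\<sigma> v = (if v \<in> X then h v else if v \<in> Y then inv_into X h v else v)" for v
  have hX: "h v \<in> Y" "h v \<notin> X" "inv_into X h (h v) = v" if "v \<in> X" for v
    using h that disjoint by (auto simp: bij_betw_def)
  have hY: "inv_into X h v \<in> X" "h (inv_into X h v) = v" if "v \<in> Y" for v
    using h that by (auto simp: bij_betw_def inv_into_into f_inv_into_f)
  have "bij_betw \<sigma> V V"
    \<comment> \<open>\<open>\<sigma>\<close> is an involution, hence its own inverse.\<close>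
    by (rule bij_betw_byWitness[where f' = \<sigma>]) (use hX hY disjoint in \<open>auto simp: \<sigma>_def\<close>)
  then have "\<sigma> permutes V"
    by (rule bij_imp_permutes) (auto simp: \<sigma>_def)
  then have "alternating \<sigma>"
    using hX hY by (auto simp: alternating_def \<sigma>_def)
  then show ?thesis by blast
qed

lemma alternating_exchange:
  assumes "alternating \<sigma>" "u \<in> V" "v \<in> side u"
  shows "alternating (\<sigma> \<circ> transpose u v)"
proof -
  have "v \<in> V" "v \<in> X \<longleftrightarrow> u \<in> X"
    using assms(2,3) disjoint by (auto simp: side_def split: if_splits)
  moreover have "\<sigma> \<circ> transpose u v permutes V"
    using assms(2) \<open>v \<in> V\<close> alternatingD(1)[OF assms(1)] by (intro permutes_compose permutes_swap_id)
  ultimately show ?thesis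
    using assms(2) alternatingD(5)[OF assms(1)]
    by (auto simp: alternating_def transpose_def)
qed

text \<open>Pulling out-neighbours of \<open>v\<close> back along \<open>\<sigma>\<close> places
  them in the class of \<open>v\<close>, where they can be compared with in-neighbours of
  \<open>\<sigma> v\<close>. Below, \<open>C\<close> is empty or a union of cycles.\<close>

lemma card_out_preimage:
  assumes "alternating \<sigma>" "v \<in> V"
  shows "card {w \<in> side v - C. (v, \<sigma> w) \<in> R} = card (R `` {v} - \<sigma> ` C)"
proof -
  have "\<sigma> ` {w \<in> side v - C. (v, \<sigma> w) \<in> R} = R `` {v} - \<sigma> ` C"
  proof safe
    fix w assume w: "(v, w) \<in> R" "w \<notin> \<sigma> ` C"
    then have "w \<in> \<sigma> ` side v"
      using out_side[OF assms] alternating_image_side[OF assms] by auto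
    with w show "w \<in> \<sigma> ` {w \<in> side v - C. (v, \<sigma> w) \<in> R}" by auto
  qed (use alternatingD(3)[OF assms(1)] in \<open>auto dest: injD\<close>)
  moreover have "card (\<sigma> ` {w \<in> side v - C. (v, \<sigma> w) \<in> R}) = card {w \<in> side v - C. (v, \<sigma> w) \<in> R}"
    using inj_on_subset[OF alternatingD(3)[OF assms(1)]] by (intro card_image) simp
  ultimately show ?thesis by simp
qed

section \<open>Half-degrees and the existence of a cycle factor\<close>

text \<open>All neighbours lie in one class, so each half-degree is at most \<open>a\<close>; the
  degree bound leaves at least \<open>(a + 1) / 2\<close> for the other.\<close>

lemma half_degrees:
  assumes "v \<in> V"
  shows "a + 1 \<le> 2 * card (R `` {v})" "a + 1 \<le> 2 * card (R\<inverse> `` {v})"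
proof -
  have "R `` {v} \<subseteq> X \<or> R `` {v} \<subseteq> Y" "R\<inverse> `` {v} \<subseteq> X \<or> R\<inverse> `` {v} \<subseteq> Y"
    using arcs disjoint assms by blast+
  then have "card (R `` {v}) \<le> a" "card (R\<inverse> `` {v}) \<le> a"
    using card_mono[OF finite_X] card_mono[OF finite_Y] unfolding card_X card_Y by blast+
  then show "a + 1 \<le> 2 * card (R `` {v})" "a + 1 \<le> 2 * card (R\<inverse> `` {v})"
    using dense[OF assms] unfolding distrib_left by linarith+
qed

text \<open>An alternating permutation using the most arcs of \<open>R\<close> is a cycle factor,
  since any bad vertex admits an improving exchange.\<close>

lemma cycle_factor_exists: "\<exists>\<sigma>. cycle_factor \<sigma>"
proof -
  define good where "good \<sigma> = {v \<in> V. (v, \<sigma> v) \<in> R}" for \<sigma>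
  have fin: "finite (good \<sigma>)" for \<sigma>
    using finite_V by (simp add: good_def)
  have "card (good \<sigma>) < Suc (card V)" for \<sigma>
    unfolding less_Suc_eq_le by (rule card_mono[OF finite_V]) (auto simp: good_def)
  then obtain \<sigma> where \<sigma>: "alternating \<sigma>"
    and max: "\<And>\<tau>. alternating \<tau> \<Longrightarrow> card (good \<tau>) \<le> card (good \<sigma>)"
    using alternating_exists arg_max_nat_lemma[of alternating _ "\<lambda>\<sigma>. card (good \<sigma>)"] by metis
  have "(x, \<sigma> x) \<in> R" if x: "x \<in> V" for x
  proof (rule ccontr)
    assume bad: "(x, \<sigma> x) \<notin> R"
    \<comment> \<open>\<open>A\<close> and \<open>B\<close> lie in \<open>side x\<close>, of size
      \<open>a\<close>, and each has at least \<open>(a + 1) / 2\<close> elements, so they meet; a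
      common element is the exchange partner.\<close>
    define A where "A = {w \<in> side x. (x, \<sigma> w) \<in> R}"
    define B where "B = R\<inverse> `` {\<sigma> x}"
    have "card A = card (R `` {x})"
      using card_out_preimage[OF \<sigma> x, of "{}"] by (simp add: A_def)
    then have "a < card A + card B"
      using half_degrees(1)[OF x] half_degrees(2)[of "\<sigma> x"] alternatingD(4)[OF \<sigma> x]
      by (simp add: B_def)
    moreover have "A \<union> B \<subseteq> side x"
      using in_side[OF \<sigma> x] by (auto simp: A_def B_def)
    then have "card (A \<union> B) \<le> a"
      using card_mono[OF finite_side, of "A \<union> B" x] by (simp add: card_side)
    moreover have "finite A" "finite B"
      using finite_subset[OF \<open>A \<union> B \<subseteq> side x\<close> finite_side] by simp_all
    ultimately have "A \<inter> B \<noteq> {}"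
      using card_Un_disjoint[of A B] by auto
    then obtain y where y: "y \<in> side x" "(x, \<sigma> y) \<in> R" "(y, \<sigma> x) \<in> R"
      by (auto simp: A_def B_def)
    \<comment> \<open>\<open>y\<close> differs from \<open>x\<close> because \<open>x\<close> is
      bad. The exchange makes both good and changes no other image.\<close>
    have "good \<sigma> \<subset> good (\<sigma> \<circ> transpose x y)"
      using x y bad by (auto simp: good_def transpose_def)
    then have "card (good \<sigma>) < card (good (\<sigma> \<circ> transpose x y))"
      using fin by (rule psubset_card_mono[rotated])
    with max[OF alternating_exchange[OF \<sigma> x y(1)]] show False by simp
  qed
  with \<sigma> show ?thesis by (auto simp: cycle_factor_def)
qed

section \<open>Merging cycles into a single one\<close>

text \<open>Let \<open>c = card C\<close>. For \<open>u\<close> in \<open>C\<close>, the candidate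
  partners outside \<open>C\<close> number \<open>a - c/2\<close>, and each accounts for at most one
  of the two arcs needed; inside \<open>C\<close> there are at most \<open>c/2\<close>
  out-neighbours of \<open>u\<close> and \<open>c/2\<close> in-neighbours of
  \<open>\<sigma> u\<close>. This gives the local bound \<open>a + c/2\<close>.\<close>

lemma card_unmergeable:
  assumes \<sigma>: "alternating \<sigma>" and C: "C \<subseteq> V" "\<sigma> ` C = C" "C \<noteq> {}"
    and unmergeable: "\<And>u v. u \<in> C \<Longrightarrow> v \<in> side u - C \<Longrightarrow> (u, \<sigma> v) \<in> R \<Longrightarrow> (v, \<sigma> u) \<notin> R"
  shows "a < card C"
proof -
  have finC: "finite C"
    using C(1) finite_V finite_subset by blast
  have inj: "inj_on \<sigma> S" for S
    using alternatingD(3)[OF \<sigma>] by (rule inj_on_subset) simp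
  \<comment> \<open>As \<open>\<sigma>\<close> exchanges the classes and preserves \<open>C\<close>,
    half of \<open>C\<close> lies in each class.\<close>
  have "\<sigma> ` (C \<inter> X) = C \<inter> Y"
  proof
    show "\<sigma> ` (C \<inter> X) \<subseteq> C \<inter> Y"
      using C alternatingD(4,5)[OF \<sigma>] by blast
    show "C \<inter> Y \<subseteq> \<sigma> ` (C \<inter> X)"
    proof
      fix y assume y: "y \<in> C \<inter> Y"
      then obtain x where "x \<in> C" "y = \<sigma> x" using C(2) by blast
      with y C(1) alternatingD(5)[OF \<sigma>, of x] disjoint show "y \<in> \<sigma> ` (C \<inter> X)" by blast
    qed
  qed
  then have "card (C \<inter> X) = card (C \<inter> Y)"
    using card_image[OF inj, of "C \<inter> X"] by simp
  moreover have "C \<inter> X \<union> C \<inter> Y = C" "(C \<inter> X) \<inter> (C \<inter> Y) = {}"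
    using C(1) disjoint by blast+
  then have "card C = card (C \<inter> X) + card (C \<inter> Y)"
    using finC by (metis card_Un_disjoint finite_Int)
  ultimately have half: "2 * card (C \<inter> side v) = card C" for v
    by (simp add: side_def)
  have local_bound: "2 * (card (R `` {u}) + card (R\<inverse> `` {\<sigma> u})) \<le> 2 * a + card C" if u: "u \<in> C" for u
  proof -
    have uV: "u \<in> V" using u C(1) by blast
    define A where "A = {w \<in> side u - C. (u, \<sigma> w) \<in> R}"
    define B where "B = R\<inverse> `` {\<sigma> u} - C"
    have AB: "A \<inter> B = {}" "A \<union> B \<subseteq> side u - C"
      using unmergeable[OF u] in_side[OF \<sigma> uV] by (auto simp: A_def B_def)
    then have "card A + card B \<le> card (side u - C)"
      using finite_side card_mono[of "side u - C" "A \<union> B"] card_Un_disjoint[of A B]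
      by (metis finite_Diff finite_Un finite_subset)
    also have "card (side u - C) = a - card (C \<inter> side u)"
      using card_Diff_subset_Int[of "side u" C] finC card_side by (simp add: Int_commute)
    also have "\<dots> + card (C \<inter> side u) = a"
      using card_mono[OF finite_side, of "C \<inter> side u" u] card_side by simp
    finally have sum_AB: "card A + card B + card (C \<inter> side u) \<le> a" by simp
    have split: "card S \<le> card (S - C) + card (C \<inter> side w)" if "S \<subseteq> side w" for S w
    proof -
      have "card S \<le> card ((S - C) \<union> (C \<inter> side w))"
        using that finC finite_subset[OF that finite_side] by (intro card_mono) auto
      also have "\<dots> \<le> card (S - C) + card (C \<inter> side w)" by (rule card_Un_le)
      finally show ?thesis .
    qed
    have "card (R `` {u}) \<le> card A + card (C \<inter> side (\<sigma> u))"
      using split[OF out_side[OF \<sigma> uV]] card_out_preimage[OF \<sigma> uV, of C] C(2)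
      by (simp add: A_def)
    moreover have "card (R\<inverse> `` {\<sigma> u}) \<le> card B + card (C \<inter> side u)"
      using split[OF in_side[OF \<sigma> uV]] by (simp add: B_def)
    ultimately have "card (R `` {u}) + card (R\<inverse> `` {\<sigma> u}) \<le> a + card (C \<inter> side (\<sigma> u))"
      using sum_AB by linarith
    then show ?thesis
      using half[of "\<sigma> u"] unfolding distrib_left by linarith
  qed
  have "card C * (3 * a + 1) = (\<Sum>v\<in>C. 3 * a + 1)" by simp
  also have "\<dots> \<le> (\<Sum>v\<in>C. 2 * (card (R `` {v}) + card (R\<inverse> `` {v})))"
    using dense C(1) by (intro sum_mono) blast
  \<comment> \<open>The local bound pairs the outdegree of \<open>v\<close> with the indegree of
    \<open>\<sigma> v\<close>. Since \<open>\<sigma>\<close> permutes \<open>C\<close>, the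
    indegrees can be reindexed, so the sums over \<open>C\<close> agree.\<close>
  also have "\<dots> = (\<Sum>v\<in>C. 2 * card (R `` {v})) + (\<Sum>v\<in>\<sigma> ` C. 2 * card (R\<inverse> `` {v}))"
    by (simp add: C(2) sum.distrib algebra_simps)
  also have "\<dots> = (\<Sum>v\<in>C. 2 * (card (R `` {v}) + card (R\<inverse> `` {\<sigma> v})))"
    by (simp add: sum.reindex[OF inj] sum.distrib algebra_simps)
  also have "\<dots> \<le> (\<Sum>v\<in>C. 2 * a + card C)"
    using local_bound by (rule sum_mono)
  also have "\<dots> = card C * (2 * a + card C)" by simp
  finally have "3 * a + 1 \<le> 2 * a + card C"
    using C(3) finC by (simp add: card_gt_0_iff del: mult_Suc_right)
  then show ?thesis by simp
qed

lemma hamiltonian_factor_exists: "\<exists>\<sigma>. cycle_factor \<sigma> \<and> (\<forall>x\<in>V. orbit \<sigma> x = V)"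
proof -
  \<comment> \<open>For a permutation of \<open>V\<close>, this is the sum of the squared cycle
    lengths, so merging two cycles strictly increases it.\<close>
  define weight where "weight \<sigma> = (\<Sum>w\<in>V. card (orbit \<sigma> w))" for \<sigma> :: "'v \<Rightarrow> 'v"
  have orbit_V: "orbit \<sigma> w \<subseteq> V" if "alternating \<sigma>" "w \<in> V" for \<sigma> w
    using alternatingD(1)[OF that(1)] that(2) by (rule permutes_orbit_subset)
  have "weight \<sigma> < Suc (\<Sum>w\<in>V. card V)" if "cycle_factor \<sigma>" for \<sigma>
    unfolding weight_def less_Suc_eq_le
    using that by (intro sum_mono card_mono[OF finite_V] orbit_V) (simp_all add: cycle_factor_def)
  then obtain \<sigma> where factor: "cycle_factor \<sigma>"
    and max: "\<And>\<tau>. cycle_factor \<tau> \<Longrightarrow> weight \<tau> \<le> weight \<sigma>"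
    using cycle_factor_exists arg_max_nat_lemma[of cycle_factor _ weight] by metis
  then have \<sigma>: "alternating \<sigma>" and arc: "\<And>v. v \<in> V \<Longrightarrow> (v, \<sigma> v) \<in> R"
    by (auto simp: cycle_factor_def)
  have cyclic: "cyclic_on \<sigma> (orbit \<sigma> x)" for x
    using alternatingD(2)[OF \<sigma>] by (rule cyclic_on_orbit')
  have orbit_eq: "orbit \<sigma> y = orbit \<sigma> x" if "y \<in> orbit \<sigma> x" for x y
    using orbit_cyclic_eq3[OF cyclic that] .
  have large: "a < card (orbit \<sigma> x)" if x: "x \<in> V" for x
  proof (rule card_unmergeable[OF \<sigma>])
    show "orbit \<sigma> x \<subseteq> V" using orbit_V[OF \<sigma> x] .
    have "\<sigma> ` orbit \<sigma> x \<subseteq> orbit \<sigma> x" by (auto intro: orbit.step)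
    then show "\<sigma> ` orbit \<sigma> x = orbit \<sigma> x"
      using alternatingD(3)[OF \<sigma>] finite_cyclic_on[OF cyclic]
      by (intro endo_inj_surj) (auto intro: inj_on_subset)
    show "orbit \<sigma> x \<noteq> {}" by (rule orbit_nonempty)
  next
    fix u v
    assume u: "u \<in> orbit \<sigma> x" and v: "v \<in> side u - orbit \<sigma> x" and uv: "(u, \<sigma> v) \<in> R"
    show "(v, \<sigma> u) \<notin> R"
    proof
      assume vu: "(v, \<sigma> u) \<in> R"
      define \<tau> where "\<tau> = \<sigma> \<circ> transpose u v"
      have uV: "u \<in> V" using u orbit_V[OF \<sigma> x] by blast
      have "alternating \<tau>"
        unfolding \<tau>_def using v by (intro alternating_exchange[OF \<sigma> uV]) simp
      \<comment> \<open>\<open>uv\<close> and \<open>vu\<close> supply exactly the two new arcs of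
        \<open>\<tau>\<close>.\<close>
      moreover have "(w, \<tau> w) \<in> R" if "w \<in> V" for w
        using that uv vu arc by (auto simp: \<tau>_def transpose_def)
      ultimately have factor': "cycle_factor \<tau>" and \<tau>: "alternating \<tau>"
        by (auto simp: cycle_factor_def)
      have "v \<notin> orbit \<sigma> u" using orbit_eq[OF u] v by simp
      note grow = orbit_comp_transpose[OF alternatingD(2)[OF \<sigma>] this, folded \<tau>_def]
      have fin: "finite (orbit \<tau> w)" if "w \<in> V" for w
        using orbit_V[OF \<tau> that] finite_V finite_subset by blast
      have "weight \<sigma> < weight \<tau>"
        unfolding weight_def
      proof (rule sum_strict_mono_ex1[OF finite_V])
        show "\<forall>w\<in>V. card (orbit \<sigma> w) \<le> card (orbit \<tau> w)"
          using fin grow(2) by (auto intro: card_mono)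
        \<comment> \<open>No orbit shrinks, and that of \<open>u\<close> gains
          \<open>v\<close>.\<close>
        have "orbit \<sigma> u \<subset> orbit \<tau> u"
          using grow \<open>v \<notin> orbit \<sigma> u\<close> by blast
        then show "\<exists>w\<in>V. card (orbit \<sigma> w) < card (orbit \<tau> w)"
          using fin[OF uV] uV by (blast intro: psubset_card_mono)
      qed
      with max[OF factor'] show False by simp
    qed
  qed
  have "orbit \<sigma> x = V" if x: "x \<in> V" for x
  proof (rule ccontr)
    assume "orbit \<sigma> x \<noteq> V"
    then obtain y where y: "y \<in> V" "y \<notin> orbit \<sigma> x"
      using orbit_V[OF \<sigma> x] by blast
    have "orbit \<sigma> x \<inter> orbit \<sigma> y = {}"
      using orbit_eq y(2) permutation_self_in_orbit[OF alternatingD(2)[OF \<sigma>]] by blast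
    then have "card (orbit \<sigma> x) + card (orbit \<sigma> y) = card (orbit \<sigma> x \<union> orbit \<sigma> y)"
      by (intro card_Un_disjoint[symmetric] finite_cyclic_on[OF cyclic])
    also have "\<dots> \<le> card V"
      using orbit_V[OF \<sigma>] x y(1) by (intro card_mono[OF finite_V]) blast
    \<comment> \<open>Two disjoint cycles, each with more than \<open>a\<close> vertices, do not fit
      into \<open>2 * a\<close> vertices.\<close>
    finally show False
      using large[OF x] large[OF y(1)] card_V by simp
  qed
  with factor show ?thesis by blast
qed

end

section \<open>From an orbit to a cycle given as a list of arcs\<close>

text \<open>The starting index \<open>m\<close> is general because the induction removes the first
  arc and so shifts the start.\<close>

lemma cas_iterates:
  "pre_digraph.cas (with_proj D) ((f ^^ m) x) (map (\<lambda>i. ((f ^^ i) x, (f ^^ Suc i) x)) [m..<m + n])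
     ((f ^^ (m + n)) x)"
proof (induction n arbitrary: m)
  case 0
  then show ?case by (simp add: cas_with_proj_eq)
next
  case (Suc n)
  have "[m..<m + Suc n] = m # [Suc m..<Suc m + n]"
    by (subst upt_conv_Cons) (simp_all del: upt_Suc)
  moreover have "(f ^^ (m + Suc n)) x = (f ^^ (Suc m + n)) x"
    by simp
  ultimately show ?case
    using Suc[of "Suc m"] by (simp only: cas_with_proj_eq list.map pcas.simps fst_conv snd_conv simp_thms)
qed

lemma has_oriented_cycle_orbit:
  assumes x: "x \<in> orbit f x" and V: "orbit f x \<subseteq> pverts D"
    and arcs: "\<And>v. v \<in> orbit f x \<Longrightarrow> (v, f v) \<in> parcs D"
  shows "has_oriented_cycle (with_proj D) (card (orbit f x))"
proof -
  \<comment> \<open>The least positive \<open>n\<close> with \<open>(f ^^ n) x = x\<close>, that is,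
    the length of the cycle.\<close>
  define n where "n = funpow_dist1 f x x"
  define p where "p = map (\<lambda>i. ((f ^^ i) x, (f ^^ Suc i) x)) [0..<n]"
  have inj: "inj_on (\<lambda>i. (f ^^ i) x) {0..<n}"
    unfolding n_def using x by (rule inj_on_funpow_dist1)
  have "orbit f x = (\<lambda>i. (f ^^ i) x) ` {0..<n}"
    unfolding n_def using x by (rule orbit_conv_funpow_dist1)
  then have card: "card (orbit f x) = n"
    using card_image[OF inj] by simp
  have closed: "(f ^^ n) x = x"
    unfolding n_def using x by (rule funpow_dist1_prop)
  have n: "n > 0" by (simp add: n_def)
  have cas: "pre_digraph.cas (with_proj D) x p x"
    using cas_iterates[where D = D and m = 0 and f = f and x = x and n = n] closed by (simp add: p_def)
  have "set p \<subseteq> parcs D"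
    using arcs funpow_in_orbit[OF x] by (auto simp: p_def)
  then have walk: "pre_digraph.awalk (with_proj D) x p x"
    using cas x V by (auto simp: pre_digraph.awalk_def)
  have "tl (pre_digraph.awalk_verts (with_proj D) x p) = map (\<lambda>i. (f ^^ Suc i) x) [0..<n]"
    using pre_digraph.awalk_verts_conv'[OF cas] n by (simp add: p_def)
  \<comment> \<open>\<open>cycle\<close> requires distinctness after dropping the initial vertex,
    hence the iterates 1 to \<open>n\<close>. As the \<open>n\<close>-th iterate is the 0-th, they
    form the same set as the iterates 0 to \<open>n - 1\<close>, and injectivity follows by
    counting.\<close>
  moreover have "inj_on (\<lambda>i. (f ^^ Suc i) x) {0..<n}"
  proof (rule eq_card_imp_inj_on)
    have "(\<lambda>i. (f ^^ Suc i) x) ` {0..<n} = (\<lambda>i. (f ^^ i) x) ` {1..<Suc n}"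
      by (simp only: image_image[symmetric, of "\<lambda>i. (f ^^ i) x" Suc] image_Suc_atLeastLessThan One_nat_def)
    also have "\<dots> = (\<lambda>i. (f ^^ i) x) ` {0..<n}"
    proof -
      have "{1..<Suc n} = insert n {1..<n}" "{0..<n} = insert 0 {1..<n}" using n by auto
      then show ?thesis using closed by simp
    qed
    finally show "card ((\<lambda>i. (f ^^ Suc i) x) ` {0..<n}) = card {0..<n}"
      using card_image[OF inj] by simp
  qed simp
  ultimately have "distinct (tl (pre_digraph.awalk_verts (with_proj D) x p))"
    by (simp add: distinct_map)
  then have "pre_digraph.cycle (with_proj D) p"
    using walk n unfolding pre_digraph.cycle_def by (auto simp: p_def)
  then show ?thesis
    using card by (auto simp: has_oriented_cycle_def p_def)
qed

section \<open>Reduction of the digraph to its arc relation\<close>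

theorem theorem1p9:
  fixes D :: "'v pair_pre_digraph" and X Y :: "'v set" and a :: nat
  assumes "pair_digraph D"
    and "balanced_bipartite_digraph (with_proj D) X Y"
    and "card X = a"
    and "a \<ge> 2"
    and "real (min_degree (with_proj D)) \<ge> (3 * real a + 1) / 2"
  shows "has_oriented_cycle (with_proj D) (2 * a)"
proof -
  interpret pair_digraph D by fact
  have V: "pverts D = X \<union> Y" and disj: "X \<inter> Y = {}" and cards: "card X = card Y"
    and arcs: "\<forall>e\<in>parcs D. fst e \<in> X \<and> snd e \<in> Y \<or> fst e \<in> Y \<and> snd e \<in> X"
    using assms(2) by (auto simp: balanced_bipartite_digraph_def bipartite_digraph_def)
  have fin: "finite X" "finite Y"
    using V pair_finite_verts by auto
  \<comment> \<open>Arcs are pairs of vertices, so counting arcs at \<open>v\<close> is the same as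
    counting its out-neighbours and in-neighbours.\<close>
  have degree: "degree (with_proj D) v = card (parcs D `` {v}) + card ((parcs D)\<inverse> `` {v})" for v
  proof -
    have "out_arcs (with_proj D) v = Pair v ` (parcs D `` {v})"
      "in_arcs (with_proj D) v = (\<lambda>u. (u, v)) ` ((parcs D)\<inverse> `` {v})"
      by (auto simp: out_arcs_def in_arcs_def)
    then show ?thesis
      by (simp add: degree_def out_degree_def in_degree_def card_image inj_on_def)
  qed
  interpret dense_balanced_bipartite X Y "parcs D" a
  proof
    fix v assume "v \<in> X \<union> Y"
    then have "min_degree (with_proj D) \<le> degree (with_proj D) v"
      unfolding min_degree_def using V fin by (intro Min_le) auto
    then have "real (min_degree (with_proj D)) \<le> real (degree (with_proj D) v)"
      by (rule of_nat_mono)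
    then have "real (3 * a + 1) \<le> real (2 * degree (with_proj D) v)"
      using assms(5) by simp
    then show "3 * a + 1 \<le> 2 * (card (parcs D `` {v}) + card ((parcs D)\<inverse> `` {v}))"
      unfolding degree of_nat_le_iff .
  qed (use fin disj cards arcs assms(3) in auto)
  obtain \<sigma> where factor: "cycle_factor \<sigma>" and orbit: "\<And>x. x \<in> X \<union> Y \<Longrightarrow> orbit \<sigma> x = X \<union> Y"
    using hamiltonian_factor_exists by blast
  obtain x where x: "x \<in> X"
    using assms(3,4) by fastforce
  have "has_oriented_cycle (with_proj D) (card (orbit \<sigma> x))"
    using x orbit[of x] factor V by (intro has_oriented_cycle_orbit) (auto simp: cycle_factor_def)
  then show ?thesis
    using x orbit[of x] card_V by simp
qed

end
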